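(* Suppose the following statement is true: for all abelian groups $M,M'$ and all symmetric subsets $B\subseteq M$, $B'\subseteq M'$, if there is a graph homomorphism from $\mathrm{Cay}(M,B)$ to $\mathrm{Cay}(M',B')$, then every graph with an $(M,B)$-flow has an $(M',B')$-flow. Then every bridgeless graph has an orientable cycle double cover with at most $6$ cycles.
   Context: Graphs are finite; loops and parallel edges are allowed. A subset $B$ of an abelian group is symmetric if $B=-B$. $\mathrm{Cay}(M,B)$ is the graph with vertex set $M$ in which $x,y$ are adjacent iff $y-x\in B$ (there is a loop at every vertex if $0\in B$); groups may be infinite. A graph homomorphism is a map of vertex sets sending adjacent vertices to adjacent vertices. For an abelian group $M$, an $M$-flow on a directed graph $G=(V,E)$ is a mapping $\varphi\colon E\to M$ such that at every vertex $v$ the sum of $\varphi$ over edges leaving $v$ minus the sum of $\varphi$ over edges entering $v$ is $0$; it is an $(M,B)$-flow if $\varphi(e)\in B$ for all $e\in E$. Since $B$ is symmetric, the existence of an $(M,B)$-flow does not depend on the chosen orientation of the edges, so it makes sense for undirected graphs too. Fix an arbitrary orientation of $G$. A directed cycle is a $\mathbb{Z}$-flow $C\colon E\to\mathbb{Z}$ with all values in $\{-1,0,1\}$ (so it need not be connected and may be identically zero). An orientable cycle double cover of $G$ is an indexed family of directed cycles covering each edge exactly twice, once in each direction, i.e. for every edge $e$ exactly one member of the family has value $+1$ on $e$, exactly one has value $-1$ on $e$, and all others have value $0$ on $e$. *)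

theory Defs
  imports "HOL-Algebra.FiniteProduct" "HOL-Algebra.Elementary_Groups" "Graph_Theory.Digraph_Component"
begin

text \<open>
  A finite graph, loops and parallel edges allowed, is represented together with its
  (arbitrary) reference orientation as a \<^locale>\<open>fin_digraph\<close>. Abelian groups are
  \<^locale>\<open>comm_group\<close>s, hence written multiplicatively: \<open>y \<otimes> inv x\<close> is the difference
  \<open>y - x\<close> and \<open>\<one>\<close> is zero.
\<close>

definition symmetric_subset :: "('m, 'x) monoid_scheme \<Rightarrow> 'm set \<Rightarrow> bool" where
  "symmetric_subset M B \<longleftrightarrow> B \<subseteq> carrier M \<and> m_inv M ` B = B"

text \<open>
  A Cayley graph is simple up to loops, so it is given by its vertex set and its adjacency
  relation, which is a symmetric relation whenever \<open>B\<close> is a symmetric subset.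
\<close>

definition Cay :: "('m, 'x) monoid_scheme \<Rightarrow> 'm set \<Rightarrow> 'm pair_pre_digraph" where
  "Cay M B = \<lparr> pverts = carrier M,
     parcs = {(x, y). x \<in> carrier M \<and> y \<in> carrier M \<and> y \<otimes>\<^bsub>M\<^esub> inv\<^bsub>M\<^esub> x \<in> B} \<rparr>"

definition graph_hom :: "'a pair_pre_digraph \<Rightarrow> 'b pair_pre_digraph \<Rightarrow> ('a \<Rightarrow> 'b) \<Rightarrow> bool" where
  "graph_hom X Y h \<longleftrightarrow>
     h \<in> pverts X \<rightarrow> pverts Y \<and> (\<forall>(x, y) \<in> parcs X. (h x, h y) \<in> parcs Y)"

definition group_flow ::
    "('m, 'x) monoid_scheme \<Rightarrow> ('v, 'e) pre_digraph \<Rightarrow> ('e \<Rightarrow> 'm) \<Rightarrow> bool" where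
  "group_flow M G \<phi> \<longleftrightarrow>
     \<phi> \<in> arcs G \<rightarrow> carrier M \<and>
     (\<forall>v \<in> verts G. finprod M \<phi> (out_arcs G v) \<otimes>\<^bsub>M\<^esub> inv\<^bsub>M\<^esub> (finprod M \<phi> (in_arcs G v)) = \<one>\<^bsub>M\<^esub>)"

text \<open>
  For a symmetric \<open>B\<close> the following property does not depend on the orientation of \<open>G\<close>.
\<close>

definition has_flow_in ::
    "('m, 'x) monoid_scheme \<Rightarrow> 'm set \<Rightarrow> ('v, 'e) pre_digraph \<Rightarrow> bool" where
  "has_flow_in M B G \<longleftrightarrow> (\<exists>\<phi>. group_flow M G \<phi> \<and> (\<forall>e \<in> arcs G. \<phi> e \<in> B))"

definition directed_cycle :: "('v, 'e) pre_digraph \<Rightarrow> ('e \<Rightarrow> int) \<Rightarrow> bool" where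
  "directed_cycle G C \<longleftrightarrow>
     group_flow integer_group G C \<and> (\<forall>e \<in> arcs G. C e \<in> {-1, 0, 1})"

text \<open>The family \<open>C 0, \<dots>, C (k - 1)\<close> is an orientable cycle double cover of \<open>G\<close>.\<close>

definition orientable_cycle_double_cover ::
    "('v, 'e) pre_digraph \<Rightarrow> nat \<Rightarrow> (nat \<Rightarrow> 'e \<Rightarrow> int) \<Rightarrow> bool" where
  "orientable_cycle_double_cover G k C \<longleftrightarrow>
     (\<forall>i<k. directed_cycle G (C i)) \<and>
     (\<forall>e \<in> arcs G. \<exists>i<k. \<exists>j<k. C i e = 1 \<and> C j e = -1 \<and>
        (\<forall>l<k. l \<noteq> i \<longrightarrow> l \<noteq> j \<longrightarrow> C l e = 0))"

text \<open>
  A bridge is an edge whose ends are separated by its deletion from the underlying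
  undirected graph. In particular, a loop is never a bridge.
\<close>

definition bridge :: "('v, 'e) pre_digraph \<Rightarrow> 'e \<Rightarrow> bool" where
  "bridge G e \<longleftrightarrow>
     e \<in> arcs G \<and> \<not> tail G e \<rightarrow>\<^sup>*\<^bsub>mk_symmetric (pre_digraph.del_arc G e)\<^esub> head G e"

definition bridgeless :: "('v, 'e) pre_digraph \<Rightarrow> bool" where
  "bridgeless G \<longleftrightarrow> (\<forall>e \<in> arcs G. \<not> bridge G e)"

end

theory Submission
  imports Defs "HOL-Algebra.Weak_Morphisms" "HOL-Library.Countable"
begin

text \<open>
  Write \<open>e\<^sub>0, \<dots>, e\<^sub>5\<close> for the standard basis of \<open>\<int>\<^sup>6\<close>. An orientable double cover by six cycles is
  the same thing as a flow all of whose values have the form \<open>e\<^sub>i - e\<^sub>j\<close> with \<open>i \<noteq> j\<close>: the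
  coordinates of the flow are the cycles. The six basis vectors are pairwise adjacent in the
  Cayley graph of \<open>\<int>\<^sup>6\<close> with respect to these differences, and \<open>Cay \<int>\<^sub>6 (\<int>\<^sub>6 - {0})\<close> is the
  complete graph on six vertices; so the latter maps homomorphically to the former, and the
  hypothesis turns every nowhere-zero \<open>\<int>\<^sub>6\<close>-flow into a double cover. What remains is
  Seymour's theorem that every bridgeless graph has a nowhere-zero \<open>\<int>\<^sub>6\<close>-flow
  (\<open>seymour_six_flow\<close>).

  Since the groups may be chosen after the graph is given, \<open>\<int>\<^sup>6\<close> can be replaced by \<open>\<int>\<close>, with
  \<open>e\<^sub>i\<close> represented by \<open>N ^ i\<close> for a base \<open>N\<close> exceeding the number of arcs: the net outflow of
  a candidate cycle at a vertex is then a base-\<open>N\<close> digit, so it vanishes as soon as the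
  number having these digits does (\<open>cycle_double_cover_of_power_difference_flow\<close>). Both groups
  are copied into the given infinite types along injections
  (\<open>flow_transfer_between_integer_groups\<close>).

  Seymour's theorem is proved along the lines of his original argument. A cut with no arcs or
  with two arcs is removed by identifying two vertices, so every cut may be assumed to have at
  least three arcs. It then suffices to find a \<open>\<int>\<^sub>2\<close>-flow \<open>c\<close> and a \<open>\<int>\<^sub>3\<close>-flow \<open>g\<close> without a
  common zero, because \<open>3 c + 2 g\<close> is then nowhere zero modulo 6. The support of \<open>c\<close> is
  collected piece by piece while a vertex set \<open>X\<close> grows. At each stage a part \<open>W\<close> outside \<open>X\<close>
  is found that is connected by a new piece of \<open>c\<close> and joined to \<open>X\<close> by at least two arcs. Two
  joining arcs are what makes the step work: a circuit through both can be added to \<open>g\<close> with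
  one of three coefficients, and at most two of these create a zero on one of the two arcs
  (\<open>repairable_extend\<close>). That such a part exists is the content of
  \<open>two_joins_to_even_flow\<close>.
\<close>

section \<open>Integer-valued arc functions and their net outflow\<close>

text \<open>
  Cutting a walk after its last visit to its first vertex: the remaining part avoids that
  vertex, which allows induction on the set of permitted vertices.
\<close>

lemma rtrancl_leave_start:
  assumes "(u, w) \<in> r\<^sup>*" "u \<noteq> w"
  obtains v where "(u, v) \<in> r" "v \<noteq> u" "(v, w) \<in> (r \<inter> (- {u}) \<times> (- {u}))\<^sup>*"
proof -
  let ?r = "r \<inter> (- {u}) \<times> (- {u})"
  have "(a \<noteq> u \<and> (a, w) \<in> ?r\<^sup>*) \<or> (\<exists>v. (u, v) \<in> r \<and> v \<noteq> u \<and> (v, w) \<in> ?r\<^sup>*)"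
    if "(a, w) \<in> r\<^sup>*" for a
    using that
  proof (induction rule: converse_rtrancl_induct)
    case base
    then show ?case using assms(2) by auto
  next
    case (step y z)
    then show ?case
      by (cases "y = u") (auto intro: converse_rtrancl_into_rtrancl)
  qed
  from this [OF assms(1)] show thesis using that by blast
qed

locale arc_system =
  fixes E :: "'e set" and src tgt :: "'e \<Rightarrow> 'v"
  assumes finite_arcs: "finite E"
begin

definition net :: "('e \<Rightarrow> int) \<Rightarrow> 'v set \<Rightarrow> int" where
  "net f S = (\<Sum>e\<in>E. f e * (of_bool (src e \<in> S) - of_bool (tgt e \<in> S)))"

definition cut :: "'v set \<Rightarrow> 'e set" where
  "cut S = {e \<in> E. (src e \<in> S) \<noteq> (tgt e \<in> S)}"

definition inside :: "'v set \<Rightarrow> 'e set" where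
  "inside S = {e \<in> E. src e \<in> S \<and> tgt e \<in> S}"

text \<open>
  Group-valued flows are handled through integer representatives, so that flows modulo 2, 3
  and 6 can be added and scaled in one place.
\<close>

definition flow_mod :: "int \<Rightarrow> ('e \<Rightarrow> int) \<Rightarrow> bool" where
  "flow_mod n f \<longleftrightarrow> (\<forall>v. n dvd net f {v})"

text \<open>
  \<open>f\<close> transports \<open>k\<close> units from \<open>u\<close> to \<open>w\<close>. Such functions take the place of walks in the
  underlying undirected graph: reversal and concatenation become negation and addition, and
  closed walks become flows.
\<close>

definition moves :: "('e \<Rightarrow> int) \<Rightarrow> int \<Rightarrow> 'v \<Rightarrow> 'v \<Rightarrow> bool" where
  "moves f k u w \<longleftrightarrow> (\<forall>v. net f {v} = k * (of_bool (v = u) - of_bool (v = w)))"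

lemma finite_cut [simp]: "finite (cut S)" and finite_inside [simp]: "finite (inside S)"
  using finite_arcs by (auto simp: cut_def inside_def)

lemma net_add: "net (\<lambda>e. f e + g e) S = net f S + net g S"
  by (simp add: net_def distrib_right sum.distrib)

lemma net_scale: "net (\<lambda>e. c * f e) S = c * net f S"
  by (simp add: net_def mult.assoc sum_distrib_left)

lemma net_const_0 [simp]: "net (\<lambda>e. 0) S = 0"
  by (simp add: net_def)

lemma net_single:
  assumes "a \<in> E"
  shows "net (\<lambda>e. of_bool (e = a)) S = of_bool (src a \<in> S) - of_bool (tgt a \<in> S)"
proof -
  have "net (\<lambda>e. of_bool (e = a)) S
      = (\<Sum>e\<in>E. if e = a then of_bool (src a \<in> S) - of_bool (tgt a \<in> S) else 0)"
    unfolding net_def by (rule sum.cong) auto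
  then show ?thesis using assms finite_arcs by simp
qed

lemma net_Un_disjoint:
  assumes "S \<inter> T = {}"
  shows "net f (S \<union> T) = net f S + net f T"
  unfolding net_def sum.distrib [symmetric]
  by (rule sum.cong) (use assms in \<open>auto simp: algebra_simps\<close>)

lemma net_sum_vertices:
  assumes "finite S"
  shows "net f S = (\<Sum>v\<in>S. net f {v})"
  using assms
proof induction
  case empty
  then show ?case by (simp add: net_def)
next
  case (insert x S)
  then show ?case using net_Un_disjoint [of "{x}" S f] by simp
qed

lemma moves_self [simp]: "moves (\<lambda>e. 0) k u u"
  by (simp add: moves_def)

lemma moves_single: "a \<in> E \<Longrightarrow> moves (\<lambda>e. of_bool (e = a)) 1 (src a) (tgt a)"
  by (auto simp: moves_def net_single)

lemma moves_uminus: "moves f k u w \<Longrightarrow> moves (\<lambda>e. - f e) k w u"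
  using net_scale [of "-1" f] by (auto simp: moves_def algebra_simps)

lemma moves_trans: "moves f k u w \<Longrightarrow> moves g k w x \<Longrightarrow> moves (\<lambda>e. f e + g e) k u x"
  by (simp add: moves_def net_add right_diff_distrib distrib_right)

lemma moves_add: "moves f k u w \<Longrightarrow> moves g l u w \<Longrightarrow> moves (\<lambda>e. f e + g e) (k + l) u w"
  by (simp add: moves_def net_add right_diff_distrib distrib_right)

lemma moves_closed_flow: "moves f k u u \<Longrightarrow> flow_mod n f"
  by (simp add: moves_def flow_mod_def)

lemma flow_mod_add: "flow_mod n f \<Longrightarrow> flow_mod n g \<Longrightarrow> flow_mod n (\<lambda>e. f e + g e)"
  by (simp add: flow_mod_def net_add)

lemma flow_mod_scale: "flow_mod n f \<Longrightarrow> flow_mod n (\<lambda>e. c * f e)"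
  by (simp add: flow_mod_def net_scale)

section \<open>Two edge-disjoint paths as an integral flow of value two\<close>

definition residual :: "('e \<Rightarrow> int) \<Rightarrow> 'e set \<Rightarrow> ('v \<times> 'v) set" where
  "residual f A = {(u, w). \<exists>e\<in>A. (src e = u \<and> tgt e = w \<and> f e < 1) \<or>
                                   (tgt e = u \<and> src e = w \<and> f e > -1)}"

text \<open>
  The usual augmentation of a unit-capacity flow. A walk that repeats a vertex could use an
  arc twice, and then \<open>f\<close> and the residual relation would not describe the capacity left on
  it. The induction therefore removes the first vertex \<open>u\<close> from the permitted set \<open>Z\<close>, so that
  the arc leaving \<open>u\<close> is still unchanged when it is used.
\<close>

lemma augment_along_residual_path:
  assumes "finite Z" "A \<subseteq> E" "(u, w) \<in> (residual f A \<inter> Z \<times> Z)\<^sup>*" "u \<in> Z"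
    and "\<And>e. \<bar>f e\<bar> \<le> 1"
  obtains f' where "\<And>e. \<bar>f' e\<bar> \<le> 1"
    and "\<And>e. f' e \<noteq> f e \<Longrightarrow> e \<in> A \<and> src e \<in> Z \<and> tgt e \<in> Z"
    and "moves (\<lambda>e. f' e - f e) 1 u w"
proof -
  have "\<exists>f'. (\<forall>e. \<bar>f' e\<bar> \<le> 1) \<and> (\<forall>e. f' e \<noteq> f e \<longrightarrow> e \<in> A \<and> src e \<in> Z \<and> tgt e \<in> Z)
      \<and> moves (\<lambda>e. f' e - f e) 1 u w"
    using assms(1,3,4)
  proof (induction "card Z" arbitrary: Z u rule: less_induct)
    case less
    show ?case
    proof (cases "u = w")
      case True
      then show ?thesis using assms(5) by (intro exI [of _ f]) auto
    next
      case False
      let ?r = "residual f A \<inter> Z \<times> Z" and ?Z = "Z - {u}"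
      obtain v where v: "(u, v) \<in> ?r" "v \<noteq> u" "(v, w) \<in> (?r \<inter> (- {u}) \<times> (- {u}))\<^sup>*"
        using rtrancl_leave_start [OF less.prems(2) False] by blast
      have "?r \<inter> (- {u}) \<times> (- {u}) = residual f A \<inter> ?Z \<times> ?Z" by auto
      moreover have "card ?Z < card Z"
        using less.prems by (intro psubset_card_mono) auto
      ultimately obtain f' where f': "\<And>e. \<bar>f' e\<bar> \<le> 1"
          "\<And>e. f' e \<noteq> f e \<Longrightarrow> e \<in> A \<and> src e \<in> ?Z \<and> tgt e \<in> ?Z"
          "moves (\<lambda>e. f' e - f e) 1 v w"
        using less.hyps [of ?Z v] v less.prems by auto
      from v(1) obtain a where a: "a \<in> A"
        "(src a = u \<and> tgt a = v \<and> f a < 1) \<or> (tgt a = u \<and> src a = v \<and> f a > -1)"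
        by (auto simp: residual_def)
      \<comment> \<open>The inductive change is confined to arcs inside \<open>Z - {u}\<close>.\<close>
      have [simp]: "f' a = f a" using f'(2) [of a] a(2) by auto
      from v(1) have uv: "u \<in> Z" "v \<in> Z" by auto
      define s :: int where "s = (if src a = u then 1 else -1)"
      have mv: "moves (\<lambda>e. s * of_bool (e = a)) 1 u v"
        using moves_single [of a] moves_uminus [OF moves_single [of a]] a assms(2) v(2)
        by (auto simp: s_def)
      let ?g = "\<lambda>e. f' e + s * of_bool (e = a)"
      have "moves (\<lambda>e. ?g e - f e) 1 u w"
        using moves_trans [OF mv f'(3)] by (simp add: algebra_simps)
      moreover have "\<bar>?g e\<bar> \<le> 1" for e
        using f'(1) [of e] a(2) v(2) by (cases "e = a") (auto simp: s_def)
      moreover have "e \<in> A \<and> src e \<in> Z \<and> tgt e \<in> Z" if "?g e \<noteq> f e" for e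
        using that f'(2) [of e] a uv by (cases "e = a") auto
      ultimately show ?thesis by (intro exI [of _ ?g]) blast
    qed
  qed
  then show thesis using that by blast
qed

text \<open>
  The case of max-flow min-cut that is needed: if \<open>y2\<close> cannot be reached from \<open>y1\<close> in the
  residual relation, then every arc leaving the reached set \<open>R\<close> is saturated, so the value \<open>k\<close>
  is the size of a cut and hence at least 2.
\<close>

lemma increase_flow_value:
  assumes "finite Y" "y1 \<in> Y" "y2 \<in> Y"
    and conn: "\<And>S. y1 \<in> S \<Longrightarrow> y2 \<notin> S \<Longrightarrow> 2 \<le> card (cut S \<inter> inside Y)"
    and f: "\<And>e. \<bar>f e\<bar> \<le> 1" "\<And>e. f e \<noteq> 0 \<Longrightarrow> e \<in> inside Y" "moves f k y1 y2" and "k < 2"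
  obtains f' where "\<And>e. \<bar>f' e\<bar> \<le> 1" "\<And>e. f' e \<noteq> 0 \<Longrightarrow> e \<in> inside Y" "moves f' (k + 1) y1 y2"
proof -
  let ?A = "inside Y"
  let ?r = "residual f ?A \<inter> Y \<times> Y"
  define R where "R = {v. (y1, v) \<in> ?r\<^sup>*}"
  have "R \<subseteq> Y"
    unfolding R_def using assms(2) by (auto elim: rtranclE)
  then have "finite R" using assms(1) finite_subset by blast
  have y1R: "y1 \<in> R" by (simp add: R_def)
  have "y2 \<in> R"
  proof (rule ccontr)
    assume y2: "y2 \<notin> R"
    have closed: "w \<in> R" if "v \<in> R" "(v, w) \<in> residual f ?A" for v w
    proof -
      have "(v, w) \<in> ?r" using that by (auto simp: residual_def inside_def)
      then show ?thesis using that(1) unfolding R_def by (auto intro: rtrancl_into_rtrancl)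
    qed
    have sat: "f e * (of_bool (src e \<in> R) - of_bool (tgt e \<in> R))
        = of_bool (e \<in> cut R \<inter> ?A)" if "e \<in> E" for e
    proof (cases "e \<in> ?A")
      case True
      have "f e = 1" if "src e \<in> R" "tgt e \<notin> R"
        using closed [of "src e" "tgt e"] that True f(1) [of e] by (force simp: residual_def)
      moreover have "f e = -1" if "tgt e \<in> R" "src e \<notin> R"
        using closed [of "tgt e" "src e"] that True f(1) [of e] by (force simp: residual_def)
      ultimately show ?thesis using True that by (auto simp: cut_def)
    next
      case False
      then show ?thesis using f(2) by auto
    qed
    have "net f R = (\<Sum>e\<in>E. of_bool (e \<in> cut R \<inter> ?A))"
      unfolding net_def by (rule sum.cong) (use sat in auto)
    also have "\<dots> = int (card (cut R \<inter> ?A))"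
      using finite_arcs by (simp add: cut_def Int_def)
    finally have "net f R \<ge> 2" using conn [OF y1R y2] by simp
    moreover have "net f R = (\<Sum>v\<in>R. if v = y1 then k else 0)"
      unfolding net_sum_vertices [OF \<open>finite R\<close>]
      by (rule sum.cong) (use f(3) y2 in \<open>auto simp: moves_def\<close>)
    ultimately show False using \<open>finite R\<close> y1R \<open>k < 2\<close> by simp
  qed
  then have path: "(y1, y2) \<in> ?r\<^sup>*" by (simp add: R_def)
  have "?A \<subseteq> E" by (auto simp: inside_def)
  then obtain f' where f': "\<And>e. \<bar>f' e\<bar> \<le> 1"
      "\<And>e. f' e \<noteq> f e \<Longrightarrow> e \<in> ?A \<and> src e \<in> Y \<and> tgt e \<in> Y"
      "moves (\<lambda>e. f' e - f e) 1 y1 y2"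
    by (rule augment_along_residual_path [OF assms(1) _ path assms(2) f(1)]) auto
  show thesis
  proof (rule that [of f'])
    show "moves f' (k + 1) y1 y2"
      using moves_add [OF f(3) f'(3)] by simp
    show "e \<in> ?A" if "f' e \<noteq> 0" for e
      using that f'(2) [of e] f(2) [of e] by (cases "f' e = f e") auto
  qed (rule f'(1))
qed

text \<open>
  Connectedness of \<open>W\<close> by arcs of \<open>A\<close>, expressed with transports instead of walks.
\<close>

definition linked :: "'e set \<Rightarrow> 'v set \<Rightarrow> bool" where
  "linked A W \<longleftrightarrow> (\<forall>u\<in>W. \<forall>w\<in>W. \<exists>p. moves p 1 u w \<and> (\<forall>e. p e \<noteq> 0 \<longrightarrow> e \<in> A))"

lemma linkedD:
  assumes "linked A W" "u \<in> W" "w \<in> W"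
  shows "\<exists>p. moves p 1 u w \<and> (\<forall>e. p e \<noteq> 0 \<longrightarrow> e \<in> A)"
  using assms unfolding linked_def by blast

lemma linked_from:
  assumes "\<And>w. w \<in> W \<Longrightarrow> \<exists>p. moves p 1 u w \<and> (\<forall>e. p e \<noteq> 0 \<longrightarrow> e \<in> A)"
  shows "linked A W"
  unfolding linked_def
proof (intro ballI)
  fix x y assume xy: "x \<in> W" "y \<in> W"
  obtain p where p: "moves p 1 u x" "\<forall>e. p e \<noteq> 0 \<longrightarrow> e \<in> A"
    using assms [OF xy(1)] by blast
  obtain q where q: "moves q 1 u y" "\<forall>e. q e \<noteq> 0 \<longrightarrow> e \<in> A"
    using assms [OF xy(2)] by blast
  have "e \<in> A" if "- p e + q e \<noteq> 0" for e
    using that p(2) q(2) by (cases "q e = 0") auto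
  then show "\<exists>p. moves p 1 x y \<and> (\<forall>e. p e \<noteq> 0 \<longrightarrow> e \<in> A)"
    using moves_trans [OF moves_uminus [OF p(1)] q(1)] by blast
qed

text \<open>
  An algebraic form of Menger's theorem for two arc-disjoint paths. Increasing the zero flow
  twice gives a flow of value 2 with values in \<open>{-1, 0, 1}\<close>. Its net outflow is even
  everywhere, so its support is an even subgraph. Restricting it to the component \<open>W\<close> of
  \<open>y1\<close> in the support leaves the net outflow at the vertices of \<open>W\<close> unchanged; as that must
  sum to 0 over \<open>W\<close>, the sink \<open>y2\<close> lies in the same component.
\<close>

lemma linked_even_flow_through_two_vertices:
  assumes "finite Y" "y1 \<in> Y" "y2 \<in> Y"
    and conn: "\<And>S. y1 \<in> S \<Longrightarrow> y2 \<notin> S \<Longrightarrow> 2 \<le> card (cut S \<inter> inside Y)"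
  obtains d W where "y1 \<in> W" "y2 \<in> W" "W \<subseteq> Y" "flow_mod 2 d"
    and "\<And>e. d e \<noteq> 0 \<Longrightarrow> e \<in> inside W" "linked {e \<in> E. odd (d e)} W"
proof -
  obtain g where g: "\<And>e. \<bar>g e\<bar> \<le> 1" "\<And>e. g e \<noteq> 0 \<Longrightarrow> e \<in> inside Y" "moves g (0 + 1) y1 y2"
    by (rule increase_flow_value [OF assms, of "\<lambda>e. 0" 0]) (auto simp: moves_def)
  obtain f where f: "\<And>e. \<bar>f e\<bar> \<le> 1" "\<And>e. f e \<noteq> 0 \<Longrightarrow> e \<in> inside Y" "moves f (0 + 1 + 1) y1 y2"
    by (rule increase_flow_value [OF assms g]) auto
  have odd_iff: "odd (f e) \<longleftrightarrow> f e \<noteq> 0" for e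
  proof -
    from f(1) [of e] have "f e = -1 \<or> f e = 0 \<or> f e = 1" by linarith
    then show ?thesis by auto
  qed
  define R where "R w \<longleftrightarrow> (\<exists>p. moves p 1 y1 w \<and> (\<forall>e. p e \<noteq> 0 \<longrightarrow> f e \<noteq> 0))" for w
  define W where "W = {w \<in> Y. R w}"
  have y1: "y1 \<in> W"
    using assms(2) unfolding W_def R_def by (auto intro: exI [of _ "\<lambda>e. 0"])
  have step: "R w" if "R v" "moves q 1 v w" "\<And>e. q e \<noteq> 0 \<Longrightarrow> f e \<noteq> 0" for v w q
  proof -
    from that(1) obtain p where p: "moves p 1 y1 v" "\<forall>e. p e \<noteq> 0 \<longrightarrow> f e \<noteq> 0"
      unfolding R_def by blast
    have "f e \<noteq> 0" if "p e + q e \<noteq> 0" for e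
      using that p(2) \<open>q e \<noteq> 0 \<Longrightarrow> f e \<noteq> 0\<close> by (cases "q e = 0") auto
    with moves_trans [OF p(1) that(2)] show ?thesis
      unfolding R_def by blast
  qed
  have same_side: "src e \<in> W \<longleftrightarrow> tgt e \<in> W" if "f e \<noteq> 0" for e
  proof -
    have e: "e \<in> E" "src e \<in> Y" "tgt e \<in> Y" using f(2) [OF that] by (auto simp: inside_def)
    have "R (src e) \<longleftrightarrow> R (tgt e)"
      using step [OF _ moves_single [OF e(1)]] step [OF _ moves_uminus [OF moves_single [OF e(1)]]]
        that by auto
    with e show ?thesis by (simp add: W_def)
  qed
  define d where "d e = (if src e \<in> W then f e else 0)" for e
  have restrict: "net (\<lambda>e. if src e \<in> W then p e else 0) {v} = (if v \<in> W then net p {v} else 0)"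
    if "\<And>e. p e \<noteq> 0 \<Longrightarrow> f e \<noteq> 0" for p v
  proof -
    have "(if src e \<in> W then p e else 0) * (of_bool (src e \<in> {v}) - of_bool (tgt e \<in> {v}))
        = (if v \<in> W then p e * (of_bool (src e \<in> {v}) - of_bool (tgt e \<in> {v})) else 0)" for e
      using same_side [of e] that [of e] by (cases "p e = 0") auto
    then show ?thesis unfolding net_def by simp
  qed
  have dnet: "net d {v} = (if v \<in> W then net f {v} else 0)" for v
    using restrict [of f v] by (simp add: d_def [abs_def])
  have fnet: "net f {v} = 2 * (of_bool (v = y1) - of_bool (v = y2))" for v
    using f(3) by (simp add: moves_def)
  have "finite W" using assms(1) by (simp add: W_def)
  have y2: "y2 \<in> W"
  proof (rule ccontr)
    assume "y2 \<notin> W"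
    have "net d W = 0"
      unfolding net_def
    proof (intro sum.neutral ballI)
      fix e show "d e * (of_bool (src e \<in> W) - of_bool (tgt e \<in> W)) = 0"
        using same_side [of e] by (auto simp: d_def)
    qed
    moreover have "net d W = (\<Sum>v\<in>W. if v = y1 then 2 else 0)"
      unfolding net_sum_vertices [OF \<open>finite W\<close>]
      by (rule sum.cong) (use \<open>y2 \<notin> W\<close> in \<open>auto simp: dnet fnet\<close>)
    ultimately show False using \<open>finite W\<close> y1 by simp
  qed
  show thesis
  proof (rule that [of W d])
    show "flow_mod 2 d" by (simp add: flow_mod_def dnet fnet)
    show "e \<in> inside W" if "d e \<noteq> 0" for e
      using that same_side [of e] f(2) [of e] by (auto simp: d_def inside_def split: if_splits)
    show "linked {e \<in> E. odd (d e)} W"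
    proof (rule linked_from [of _ y1])
      fix w assume w: "w \<in> W"
      then obtain p where p: "moves p 1 y1 w" "\<And>e. p e \<noteq> 0 \<Longrightarrow> f e \<noteq> 0"
        by (auto simp: W_def R_def)
      let ?p = "\<lambda>e. if src e \<in> W then p e else 0"
      have "moves ?p 1 y1 w"
        using p(1) w y1 restrict [OF p(2)] by (auto simp: moves_def)
      moreover have "e \<in> {e \<in> E. odd (d e)}" if "?p e \<noteq> 0" for e
        using that p(2) [of e] odd_iff [of e] f(2) [of e] by (auto simp: d_def inside_def split: if_splits)
      ultimately show "\<exists>p. moves p 1 y1 w \<and> (\<forall>e. p e \<noteq> 0 \<longrightarrow> e \<in> {e \<in> E. odd (d e)})"
        by blast
    qed
    show "W \<subseteq> Y" by (auto simp: W_def)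
  qed (rule y1 y2)+
qed


section \<open>Enlarging the repairable vertex set\<close>

definition joins :: "'v set \<Rightarrow> 'v set \<Rightarrow> 'e set" where
  "joins X W = {e \<in> E. (src e \<in> X \<and> tgt e \<in> W) \<or> (src e \<in> W \<and> tgt e \<in> X)}"

text \<open>
  The invariant of the construction: \<open>X\<close> can be dealt with last. Whatever a flow modulo 3 looks
  like outside \<open>X\<close>, changing it on arcs inside \<open>X\<close> alone makes it nonzero on all those arcs
  that are not already covered by the \<open>\<int>\<^sub>2\<close>-flow \<open>c\<close>.
\<close>

definition repairable :: "'v set \<Rightarrow> ('e \<Rightarrow> int) \<Rightarrow> bool" where
  "repairable X c \<longleftrightarrow> (\<forall>g. flow_mod 3 g \<longrightarrow>
     (\<exists>g'. flow_mod 3 g' \<and> (\<forall>e. e \<notin> inside X \<longrightarrow> g' e = g e) \<and>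
           (\<forall>e\<in>inside X. odd (c e) \<or> \<not> 3 dvd g' e)))"

text \<open>
  The circuit that crosses from \<open>X\<close> to \<open>W\<close> along \<open>a\<close>, runs through \<open>W\<close>, returns along \<open>b\<close>
  and closes up through \<open>X\<close>.
\<close>

lemma flow_through_two_joins:
  assumes "linked A X" "linked D W" "X \<inter> W = {}" "a \<in> joins X W" "b \<in> joins X W" "a \<noteq> b"
    and "joins X W \<inter> (A \<union> D) = {}"
  shows "\<exists>z. (\<forall>n. flow_mod n z) \<and> z a = 1 \<and> (z b = 1 \<or> z b = -1) \<and>
    (\<forall>e. z e \<noteq> 0 \<longrightarrow> e = a \<or> e = b \<or> e \<in> A \<union> D)"
proof -
  \<comment> \<open>The ends of a joining arc in \<open>X\<close> and in \<open>W\<close>, and the sign of its direction.\<close>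
  define x where "x e = (if src e \<in> X then src e else tgt e)" for e
  define w where "w e = (if src e \<in> X then tgt e else src e)" for e
  define s :: "'e \<Rightarrow> int" where "s e = (if src e \<in> X then 1 else -1)" for e
  have xw: "x e \<in> X" "w e \<in> W" "moves (\<lambda>y. s e * of_bool (y = e)) 1 (x e) (w e)"
    if "e \<in> joins X W" for e
    using that assms(3) moves_single [of e] moves_uminus [OF moves_single [of e]]
    by (auto simp: joins_def x_def w_def s_def)
  obtain q where q: "moves q 1 (w a) (w b)" "\<And>e. q e \<noteq> 0 \<Longrightarrow> e \<in> D"
    using linkedD [OF assms(2) xw(2) [OF assms(4)] xw(2) [OF assms(5)]] by blast
  obtain p where p: "moves p 1 (x b) (x a)" "\<And>e. p e \<noteq> 0 \<Longrightarrow> e \<in> A"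
    using linkedD [OF assms(1) xw(1) [OF assms(5)] xw(1) [OF assms(4)]] by blast
  define z0 where "z0 e = s a * of_bool (e = a) + q e + (- (s b * of_bool (e = b))) + p e" for e
  have "moves z0 1 (x a) (x a)"
    unfolding z0_def
    using moves_trans [OF moves_trans [OF moves_trans [OF xw(3) [OF assms(4)] q(1)]
          moves_uminus [OF xw(3) [OF assms(5)]]] p(1)] .
  then have flow: "flow_mod n z0" for n by (rule moves_closed_flow)
  have "p a = 0" "q a = 0" "p b = 0" "q b = 0" using p(2) q(2) assms(4,5,7) by blast+
  then have ab: "z0 a = s a" "z0 b = - s b" using assms(6) by (auto simp: z0_def)
  show ?thesis
  proof (intro exI [of _ "\<lambda>e. s a * z0 e"] conjI allI impI)
    show "flow_mod n (\<lambda>e. s a * z0 e)" for n by (rule flow_mod_scale [OF flow])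
    show "s a * z0 a = 1" "s a * z0 b = 1 \<or> s a * z0 b = -1"
      unfolding ab by (auto simp: s_def)
    show "e = a \<or> e = b \<or> e \<in> A \<union> D" if "s a * z0 e \<noteq> 0" for e
    proof (rule ccontr)
      assume "\<not> ?thesis"
      then have "e \<noteq> a" "e \<noteq> b" "p e = 0" "q e = 0" using p(2) q(2) by blast+
      then show False using that by (simp add: z0_def)
    qed
  qed
qed

text \<open>
  If every arc of \<open>N\<close> lies on a circuit whose other arcs all belong to \<open>R\<close>, then
  repairing one arc does not disturb the others.
\<close>

lemma nonzero_mod_3_one_by_one:
  assumes "finite N" "flow_mod 3 g" "N \<inter> R = {}"
    and "\<forall>e\<in>N. \<exists>z. flow_mod 3 z \<and> z e = 1 \<and> (\<forall>y. z y \<noteq> 0 \<longrightarrow> y = e \<or> y \<in> R)"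
  shows "\<exists>g'. flow_mod 3 g' \<and> (\<forall>e. e \<notin> N \<union> R \<longrightarrow> g' e = g e) \<and> (\<forall>e\<in>N. \<not> 3 dvd g' e)"
  using assms(1,3,4)
proof (induction N)
  case empty
  then show ?case using assms(2) by auto
next
  case (insert a N)
  obtain g' where g': "flow_mod 3 g'" "\<And>e. e \<notin> N \<union> R \<Longrightarrow> g' e = g e" "\<And>e. e \<in> N \<Longrightarrow> \<not> 3 dvd g' e"
    using insert.IH insert.prems by auto
  obtain z where z: "flow_mod 3 z" "z a = 1" "\<And>y. z y \<noteq> 0 \<Longrightarrow> y = a \<or> y \<in> R"
    using insert.prems(2) by blast
  let ?g = "\<lambda>e. g' e + (1 - g' a) * z e"
  have "flow_mod 3 ?g" by (intro flow_mod_add flow_mod_scale g' z)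
  moreover have "?g e = g e" if "e \<notin> insert a N \<union> R" for e
    using that g'(2) [of e] z(3) [of e] by auto
  moreover have "\<not> 3 dvd ?g e" if "e \<in> insert a N" for e
  proof (cases "e = a")
    case True
    then show ?thesis using z(2) by simp
  next
    case False
    then have "z e = 0" using that z(3) [of e] insert.prems(1) by auto
    then show ?thesis using that False g'(3) by simp
  qed
  ultimately show ?case by blast
qed

lemma avoid_two_residues_mod_3:
  fixes a b s :: int
  assumes "s = 1 \<or> s = -1"
  shows "\<exists>c. \<not> 3 dvd a + c \<and> \<not> 3 dvd b + c * s"
  using assms by (elim disjE; simp; presburger)

text \<open>
  The new arcs are treated in this order: first the arcs inside \<open>W\<close> outside the support of \<open>d\<close>
  and the arcs joining \<open>X\<close> to \<open>W\<close> other than \<open>a\<close> and \<open>b\<close>, each by a circuit that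
  spoils only \<open>a\<close>, arcs in the support of \<open>d\<close> and arcs inside \<open>X\<close>; then \<open>a\<close> and \<open>b\<close>
  simultaneously, by a multiple of a circuit through both; and finally the arcs inside \<open>X\<close>,
  using that \<open>X\<close> is repairable.
\<close>

lemma repairable_extend:
  assumes X: "linked (inside X) X" "repairable X c" "\<And>e. c e \<noteq> 0 \<Longrightarrow> e \<in> inside X"
    and W: "linked {e \<in> E. odd (d e)} W" "\<And>e. d e \<noteq> 0 \<Longrightarrow> e \<in> inside W"
    and "X \<inter> W = {}"
    and a: "a \<in> joins X W" and b: "b \<in> joins X W" and "a \<noteq> b"
  shows "repairable (X \<union> W) (\<lambda>e. c e + d e)"
  unfolding repairable_def
proof (intro allI impI)
  fix g assume "flow_mod 3 g"
  \<comment> \<open>\<open>R\<close> collects the arcs whose value need not be protected yet.\<close>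
  define D where "D = {e \<in> E. odd (d e)}"
  define R where "R = inside X \<union> D"
  define K where "K = inside W - D"
  define J where "J = joins X W"
  have DW: "D \<subseteq> inside W" using W(2) by (force simp: D_def)
  have dis: "inside X \<inter> inside W = {}" "J \<inter> inside X = {}" "J \<inter> inside W = {}"
    using \<open>X \<inter> W = {}\<close> by (auto simp: inside_def joins_def J_def)
  have split: "inside (X \<union> W) = inside X \<union> inside W \<union> J"
    by (auto simp: inside_def joins_def J_def)
  have WD: "linked D W" using W(1) by (simp add: D_def)
  have "J \<inter> (inside X \<union> D) = {}" using DW dis by blast
  note through = flow_through_two_joins
      [OF X(1) WD \<open>X \<inter> W = {}\<close>, folded J_def, OF _ _ _ this, folded R_def]
  have aJ: "a \<in> J" and bJ: "b \<in> J" using a b by (simp_all add: J_def)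
  define N where "N = K \<union> J - {a, b}"
  have "finite N" using finite_arcs by (simp add: N_def K_def J_def joins_def)
  have "N \<inter> (R \<union> {a}) = {}" using DW dis by (auto simp: N_def K_def R_def)
  have single: "\<forall>e\<in>N. \<exists>z. flow_mod 3 z \<and> z e = 1 \<and>
      (\<forall>y. z y \<noteq> 0 \<longrightarrow> y = e \<or> y \<in> R \<union> {a})"
  proof
    fix e assume that: "e \<in> N"
    show "\<exists>z. flow_mod 3 z \<and> z e = 1 \<and> (\<forall>y. z y \<noteq> 0 \<longrightarrow> y = e \<or> y \<in> R \<union> {a})"
    proof (cases "e \<in> J")
      case True
      moreover have "e \<noteq> a" using that by (simp add: N_def)
      ultimately obtain z where z: "flow_mod 3 z" "z e = 1"
        "\<And>y. z y \<noteq> 0 \<Longrightarrow> y = e \<or> y = a \<or> y \<in> R"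
        using through [OF True aJ] by blast
      then show ?thesis by blast
    next
      case False
      then have e: "e \<in> inside W" "e \<notin> D" using that by (auto simp: N_def K_def)
      then have "tgt e \<in> W" "src e \<in> W" by (auto simp: inside_def)
      then obtain p where p: "moves p 1 (tgt e) (src e)" "\<And>y. p y \<noteq> 0 \<Longrightarrow> y \<in> D"
        using linkedD [OF WD, of "tgt e" "src e"] by blast
      have eE: "e \<in> E" using e by (simp add: inside_def)
      let ?z = "\<lambda>y. of_bool (y = e) + p y"
      have "flow_mod 3 ?z"
        by (rule moves_closed_flow [OF moves_trans [OF moves_single [OF eE] p(1)]])
      moreover have "?z e = 1" using p(2) [of e] e by auto
      moreover have "y = e \<or> y \<in> R \<union> {a}" if "?z y \<noteq> 0" for y
        using that p(2) [of y] by (cases "y = e") (auto simp: R_def)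
      ultimately show ?thesis by blast
    qed
  qed
  from nonzero_mod_3_one_by_one
    [OF \<open>finite N\<close> \<open>flow_mod 3 g\<close> \<open>N \<inter> (R \<union> {a}) = {}\<close> single]
  obtain g1 where g1: "flow_mod 3 g1" "\<forall>e. e \<notin> N \<union> (R \<union> {a}) \<longrightarrow> g1 e = g e"
      "\<forall>e\<in>N. \<not> 3 dvd g1 e"
    by (elim exE conjE)
  from through [OF aJ bJ \<open>a \<noteq> b\<close>]
  obtain z where z: "\<forall>n. flow_mod n z" "z a = 1" "z b = 1 \<or> z b = -1"
      "\<forall>y. z y \<noteq> 0 \<longrightarrow> y = a \<or> y = b \<or> y \<in> R"
    by (elim exE conjE)
  obtain k where k: "\<not> 3 dvd g1 a + k" "\<not> 3 dvd g1 b + k * z b"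
    using avoid_two_residues_mod_3 [OF z(3)] by blast
  define g2 where "g2 e = g1 e + k * z e" for e
  have "flow_mod 3 g2" unfolding g2_def by (intro flow_mod_add flow_mod_scale g1 z(1) [rule_format])
  from X(2) [unfolded repairable_def, rule_format, OF this]
  obtain g3 where g3: "flow_mod 3 g3" "\<forall>e. e \<notin> inside X \<longrightarrow> g3 e = g2 e"
      "\<forall>e\<in>inside X. odd (c e) \<or> \<not> 3 dvd g3 e"
    by (elim exE conjE)
  show "\<exists>g'. flow_mod 3 g' \<and> (\<forall>e. e \<notin> inside (X \<union> W) \<longrightarrow> g' e = g e) \<and>
      (\<forall>e\<in>inside (X \<union> W). odd (c e + d e) \<or> \<not> 3 dvd g' e)"
  proof (intro exI conjI allI ballI impI)
    show "flow_mod 3 g3" by (rule g3)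
    fix e
    show "g3 e = g e" if "e \<notin> inside (X \<union> W)"
    proof -
      have "e \<notin> inside X" "e \<notin> N" "e \<notin> R" "e \<noteq> a" "e \<noteq> b"
        using that DW aJ bJ unfolding split by (auto simp: N_def K_def R_def)
      then show ?thesis using g3(2) g1(2) z(4) by (auto simp: g2_def)
    qed
    show "odd (c e + d e) \<or> \<not> 3 dvd g3 e" if "e \<in> inside (X \<union> W)"
    proof (cases "e \<in> inside X")
      case True
      then have "d e = 0" using W(2) [of e] dis by auto
      then show ?thesis using g3(3) True by simp
    next
      case eX: False
      have c0: "c e = 0" using X(3) [of e] eX by auto
      show ?thesis
      proof (cases "e \<in> D")
        case True
        then show ?thesis using c0 by (simp add: D_def)
      next
        case False
        then have eKJ: "e \<in> K \<union> J" and eR: "e \<notin> R"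
          using that eX unfolding split by (auto simp: K_def R_def)
        have "\<not> 3 dvd g2 e"
        proof (cases "e = a \<or> e = b")
          case True
          then show ?thesis using k z(2) by (auto simp: g2_def)
        next
          case False
          then have "e \<in> N" using eKJ by (simp add: N_def)
          then have "\<not> 3 dvd g1 e" "z e = 0" using g1(3) z(4) False eR by blast+
          then show ?thesis by (simp add: g2_def)
        qed
        then show ?thesis using g3(2) eX by simp
      qed
    qed
  qed
qed

lemma linked_extend:
  assumes "linked (inside X) X" "linked D W" "D \<subseteq> inside W" "a \<in> joins X W"
  shows "linked (inside (X \<union> W)) (X \<union> W)"
proof -
  obtain x w s where xw: "x \<in> X" "w \<in> W" "moves (\<lambda>e. s * of_bool (e = a)) 1 x w"
  proof (cases "src a \<in> X \<and> tgt a \<in> W")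
    case True
    then show thesis
      using that [of "src a" "tgt a" 1] moves_single [of a] assms(4) by (auto simp: joins_def)
  next
    case False
    then show thesis
      using that [of "tgt a" "src a" "-1"] moves_uminus [OF moves_single [of a]] assms(4)
      by (auto simp: joins_def)
  qed
  have sub: "inside X \<subseteq> inside (X \<union> W)" "D \<subseteq> inside (X \<union> W)" "a \<in> inside (X \<union> W)"
    using assms(3,4) by (auto simp: inside_def joins_def)
  show ?thesis
  proof (rule linked_from [of _ x])
    fix v assume "v \<in> X \<union> W"
    show "\<exists>p. moves p 1 x v \<and> (\<forall>e. p e \<noteq> 0 \<longrightarrow> e \<in> inside (X \<union> W))"
    proof (cases "v \<in> X")
      case True
      then show ?thesis using linkedD [OF assms(1) xw(1) True] sub(1) by blast
    next
      case False
      then have "v \<in> W" using \<open>v \<in> X \<union> W\<close> by simp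
      then obtain q where q: "moves q 1 w v" "\<And>e. q e \<noteq> 0 \<Longrightarrow> e \<in> D"
        using linkedD [OF assms(2) xw(2)] by blast
      have "e \<in> inside (X \<union> W)" if "s * of_bool (e = a) + q e \<noteq> 0" for e
        using that q(2) [of e] sub by (cases "e = a") auto
      then show ?thesis using moves_trans [OF xw(3) q(1)] by blast
    qed
  qed
qed

section \<open>Seymour's theorem when every cut has at least three arcs\<close>

text \<open>
  Among the nonempty parts of \<open>V - X\<close> with at most one arc to the rest of \<open>V - X\<close>, take a
  smallest one, \<open>Y\<close>. As its cut has at least three arcs, two of them lead to \<open>X\<close>. If \<open>S\<close>
  splits \<open>Y\<close>, then by minimality both halves send at least two arcs into the rest of \<open>V - X\<close>.
  At most one of these four leaves \<open>Y\<close>, and the others run between the halves and are counted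
  twice, so there are at least two of them.
\<close>

lemma two_edge_connected_part:
  assumes "finite V" "\<And>e. e \<in> E \<Longrightarrow> src e \<in> V \<and> tgt e \<in> V"
    and cuts: "\<And>S. S \<subseteq> V \<Longrightarrow> S \<noteq> {} \<Longrightarrow> S \<noteq> V \<Longrightarrow> 3 \<le> card (cut S)"
    and X: "X \<noteq> {}" "X \<subseteq> V" "X \<noteq> V"
  obtains Y where "Y \<noteq> {}" "Y \<subseteq> V - X" "2 \<le> card (joins X Y)"
    and "\<And>S. S \<inter> Y \<noteq> {} \<Longrightarrow> Y - S \<noteq> {} \<Longrightarrow> 2 \<le> card (cut S \<inter> inside Y)"
proof -
  let ?I = "inside (V - X)"
  define loose where "loose Y \<longleftrightarrow> Y \<noteq> {} \<and> Y \<subseteq> V - X \<and> card (cut Y \<inter> ?I) \<le> 1" for Y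
  have "loose (V - X)"
  proof -
    have "cut (V - X) \<inter> ?I = {}" by (auto simp: cut_def inside_def)
    then show ?thesis using X by (auto simp: loose_def)
  qed
  from ex_has_least_nat [of loose, OF this, of card]
  obtain Y where Y: "loose Y" and min: "\<And>Z. loose Z \<Longrightarrow> card Y \<le> card Z" by blast
  have Y': "Y \<noteq> {}" "Y \<subseteq> V - X" "card (cut Y \<inter> ?I) \<le> 1" using Y by (auto simp: loose_def)
  have "finite Y" using Y'(2) assms(1) finite_subset by blast
  have two: "2 \<le> card (cut Z \<inter> ?I)" if "Z \<subseteq> Y" "Z \<noteq> {}" "Z \<noteq> Y" for Z
  proof (rule ccontr)
    assume "\<not> ?thesis"
    then have "loose Z" using that Y'(2) by (auto simp: loose_def)
    moreover have "card Z < card Y" using that \<open>finite Y\<close> by (intro psubset_card_mono) auto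
    ultimately show False using min by fastforce
  qed
  show thesis
  proof (rule that [OF Y'(1,2)])
    have "3 \<le> card (cut Y)" using cuts [of Y] Y' X by blast
    also have "cut Y \<subseteq> (cut Y \<inter> ?I) \<union> joins X Y"
      using assms(2) Y'(2) by (auto simp: cut_def inside_def joins_def)
    then have "card (cut Y) \<le> card ((cut Y \<inter> ?I) \<union> joins X Y)"
      using finite_arcs by (intro card_mono) (auto simp: joins_def)
    also have "\<dots> \<le> card (cut Y \<inter> ?I) + card (joins X Y)" by (rule card_Un_le)
    finally show "2 \<le> card (joins X Y)" using Y'(3) by linarith
  next
    fix S assume S: "S \<inter> Y \<noteq> {}" "Y - S \<noteq> {}"
    define P where "P = cut S \<inter> inside Y"
    define Q1 where "Q1 = {e \<in> cut Y \<inter> ?I. src e \<in> S \<inter> Y \<or> tgt e \<in> S \<inter> Y}"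
    define Q2 where "Q2 = {e \<in> cut Y \<inter> ?I. src e \<in> Y - S \<or> tgt e \<in> Y - S}"
    have fin: "finite P" "finite Q1" "finite Q2" by (auto simp: P_def Q1_def Q2_def)
    have "cut (S \<inter> Y) \<inter> ?I \<subseteq> P \<union> Q1"
      by (auto simp: P_def Q1_def cut_def inside_def)
    then have "card (cut (S \<inter> Y) \<inter> ?I) \<le> card P + card Q1"
      using fin by (intro order_trans [OF card_mono card_Un_le]) auto
    moreover have "cut (Y - S) \<inter> ?I \<subseteq> P \<union> Q2"
      by (auto simp: P_def Q2_def cut_def inside_def)
    then have "card (cut (Y - S) \<inter> ?I) \<le> card P + card Q2"
      using fin by (intro order_trans [OF card_mono card_Un_le]) auto
    moreover have "card Q1 + card Q2 \<le> 1"
    proof -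
      have "Q1 \<inter> Q2 = {}" by (auto simp: Q1_def Q2_def cut_def)
      then have "card Q1 + card Q2 = card (Q1 \<union> Q2)" using fin by (simp add: card_Un_disjoint)
      also have "\<dots> \<le> card (cut Y \<inter> ?I)" by (rule card_mono) (auto simp: Q1_def Q2_def)
      finally show ?thesis using Y'(3) by simp
    qed
    moreover have "2 \<le> card (cut (S \<inter> Y) \<inter> ?I)" "2 \<le> card (cut (Y - S) \<inter> ?I)"
      using two [of "S \<inter> Y"] two [of "Y - S"] S by auto
    ultimately show "2 \<le> card (cut S \<inter> inside Y)" unfolding P_def [symmetric] by linarith
  qed
qed

text \<open>
  The ends in \<open>Y\<close> of two arcs from \<open>X\<close> to \<open>Y\<close> lie in a common linked part \<open>W\<close>. If the two
  ends coincide, \<open>W\<close> may consist of that vertex alone.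
\<close>

lemma two_joins_to_even_flow:
  assumes "finite V" "\<And>e. e \<in> E \<Longrightarrow> src e \<in> V \<and> tgt e \<in> V"
    and cuts: "\<And>S. S \<subseteq> V \<Longrightarrow> S \<noteq> {} \<Longrightarrow> S \<noteq> V \<Longrightarrow> 3 \<le> card (cut S)"
    and X: "X \<noteq> {}" "X \<subseteq> V" "X \<noteq> V"
  obtains W d a b where "W \<subseteq> V - X" "W \<noteq> {}" "a \<in> joins X W" "b \<in> joins X W" "a \<noteq> b"
    and "flow_mod 2 d" "\<And>e. d e \<noteq> 0 \<Longrightarrow> e \<in> inside W" "linked {e \<in> E. odd (d e)} W"
proof -
  obtain Y where Y: "Y \<noteq> {}" "Y \<subseteq> V - X" "2 \<le> card (joins X Y)"
    and conn: "\<And>S. S \<inter> Y \<noteq> {} \<Longrightarrow> Y - S \<noteq> {} \<Longrightarrow> 2 \<le> card (cut S \<inter> inside Y)"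
    by (rule two_edge_connected_part [OF assms(1,2) cuts X]) auto
  obtain T where "T \<subseteq> joins X Y" "card T = 2" using obtain_subset_with_card_n [OF Y(3)] by metis
  then obtain a b where ab: "a \<in> joins X Y" "b \<in> joins X Y" "a \<noteq> b" by (auto simp: card_2_iff)
  define endp where "endp e = (if src e \<in> X then tgt e else src e)" for e
  have ends: "endp e \<in> Y" "\<And>W. W \<subseteq> Y \<Longrightarrow> endp e \<in> W \<Longrightarrow> e \<in> joins X W" if "e \<in> joins X Y" for e
    using that Y(2) by (auto simp: joins_def endp_def)
  have "finite Y" using Y(2) assms(1) finite_subset by blast
  moreover have "2 \<le> card (cut S \<inter> inside Y)" if "endp a \<in> S" "endp b \<notin> S" for S
    using conn [of S] that ends ab by blast
  ultimately obtain d W where dW: "endp a \<in> W" "endp b \<in> W" "W \<subseteq> Y" "flow_mod 2 d"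
      "\<And>e. d e \<noteq> 0 \<Longrightarrow> e \<in> inside W" "linked {e \<in> E. odd (d e)} W"
    by (rule linked_even_flow_through_two_vertices [OF _ ends(1) [OF ab(1)] ends(1) [OF ab(2)]])
      auto
  show thesis
  proof (rule that [OF _ _ _ _ ab(3) dW(4-6)])
    show "W \<subseteq> V - X" "W \<noteq> {}" using dW Y by auto
    show "a \<in> joins X W" "b \<in> joins X W" using ends(2) ab dW by auto
  qed
qed

lemma repairable_everywhere:
  assumes "finite V" "\<And>e. e \<in> E \<Longrightarrow> src e \<in> V \<and> tgt e \<in> V"
    and cuts: "\<And>S. S \<subseteq> V \<Longrightarrow> S \<noteq> {} \<Longrightarrow> S \<noteq> V \<Longrightarrow> 3 \<le> card (cut S)"
    and "X \<noteq> {}" "X \<subseteq> V" "linked (inside X) X" "repairable X c" "flow_mod 2 c"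
    and "\<And>e. c e \<noteq> 0 \<Longrightarrow> e \<in> inside X"
  shows "\<exists>c'. flow_mod 2 c' \<and> repairable V c'"
  using assms(4-)
proof (induction "card (V - X)" arbitrary: X c rule: less_induct)
  case less
  show ?case
  proof (cases "X = V")
    case True
    then show ?thesis using less.prems by blast
  next
    case False
    obtain W d a b where W: "W \<subseteq> V - X" "W \<noteq> {}" "a \<in> joins X W" "b \<in> joins X W" "a \<noteq> b"
      "flow_mod 2 d" "\<And>e. d e \<noteq> 0 \<Longrightarrow> e \<in> inside W" "linked {e \<in> E. odd (d e)} W"
      by (rule two_joins_to_even_flow [OF assms(1,2) cuts less.prems(1,2) False]) auto
    have XW: "X \<inter> W = {}" using W(1) by auto
    have odd_inside: "{e \<in> E. odd (d e)} \<subseteq> inside W" using W(7) by force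
    show ?thesis
    proof (rule less.hyps [of "X \<union> W" "\<lambda>e. c e + d e"])
      show "card (V - (X \<union> W)) < card (V - X)"
        using assms(1) W(1,2) by (intro psubset_card_mono) auto
      show "linked (inside (X \<union> W)) (X \<union> W)"
        by (rule linked_extend [OF less.prems(3) W(8) odd_inside W(3)])
      show "repairable (X \<union> W) (\<lambda>e. c e + d e)"
        by (rule repairable_extend [OF less.prems(3,4,6) W(8,7) XW W(3-5)])
      show "flow_mod 2 (\<lambda>e. c e + d e)" by (rule flow_mod_add [OF less.prems(5) W(6)])
      show "e \<in> inside (X \<union> W)" if "c e + d e \<noteq> 0" for e
        using that less.prems(6) [of e] W(7) [of e] by (cases "c e = 0") (auto simp: inside_def)
    qed (use less.prems W(1) in auto)
  qed
qed

text \<open>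
  The construction starts at a single vertex, where only loops have to be repaired and any
  value may be given to them, and it ends with \<open>X = V\<close>, where every flow modulo 3, in
  particular the zero flow, can be repaired on all arcs.
\<close>

lemma six_flow_of_three_edge_connected:
  assumes "finite V" "\<And>e. e \<in> E \<Longrightarrow> src e \<in> V \<and> tgt e \<in> V"
    and "\<And>S. S \<subseteq> V \<Longrightarrow> S \<noteq> {} \<Longrightarrow> S \<noteq> V \<Longrightarrow> 3 \<le> card (cut S)"
  shows "\<exists>f. flow_mod 6 f \<and> (\<forall>e\<in>E. \<not> 6 dvd f e)"
proof (cases "V = {}")
  case True
  then have "E = {}" using assms(2) by blast
  moreover have "flow_mod 6 (\<lambda>e. 0)" by (simp add: flow_mod_def)
  ultimately show ?thesis by blast
next
  case False
  then obtain v where v: "v \<in> V" by blast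
  have "repairable {v} (\<lambda>e. 0)"
    unfolding repairable_def
  proof (intro allI impI)
    fix g assume g: "flow_mod 3 g"
    let ?g = "\<lambda>e. if e \<in> inside {v} then 1 else g e"
    have "net ?g S = net g S" for S
      unfolding net_def by (rule sum.cong) (auto simp: inside_def)
    then have "flow_mod 3 ?g" using g by (simp add: flow_mod_def)
    then show "\<exists>g'. flow_mod 3 g' \<and> (\<forall>e. e \<notin> inside {v} \<longrightarrow> g' e = g e) \<and>
        (\<forall>e\<in>inside {v}. odd (0::int) \<or> \<not> 3 dvd g' e)"
      by (intro exI [of _ ?g]) auto
  qed
  moreover have "linked (inside {v}) {v}"
    using moves_self [of 1 v] unfolding linked_def by (metis singletonD)
  ultimately obtain c where c: "flow_mod 2 c" "repairable V c"
    using repairable_everywhere [OF assms, of "{v}" "\<lambda>e. 0"] v by (auto simp: flow_mod_def)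
  have "flow_mod 3 (\<lambda>e. 0)" by (simp add: flow_mod_def)
  then obtain g where g: "flow_mod 3 g" "\<And>e. e \<in> inside V \<Longrightarrow> odd (c e) \<or> \<not> 3 dvd g e"
    using c(2) unfolding repairable_def by blast
  let ?f = "\<lambda>e. 3 * c e + 2 * g e"
  have "flow_mod 6 ?f"
    unfolding flow_mod_def
  proof
    fix w
    have "2 dvd net c {w}" "3 dvd net g {w}" using c(1) g(1) by (auto simp: flow_mod_def)
    then show "6 dvd net ?f {w}" unfolding net_add net_scale by presburger
  qed
  moreover have "\<not> 6 dvd ?f e" if "e \<in> E" for e
  proof -
    have "odd (c e) \<or> \<not> 3 dvd g e" using g(2) assms(2) that by (auto simp: inside_def)
    then show ?thesis by presburger
  qed
  ultimately show ?thesis by blast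
qed

end

section \<open>Seymour's theorem for bridgeless graphs\<close>

text \<open>
  Induction on the number of vertices. Let \<open>S\<close> have a cut of size 0 or 2, and identify a vertex
  \<open>s\<close> of \<open>S\<close> with a vertex \<open>t\<close> outside, choosing the ends of a cut arc \<open>a\<close> if there is one;
  \<open>a\<close> stays as a loop. Cuts of the new graph are cuts of the old one. A flow of the new
  graph can be unbalanced in the old one only at \<open>s\<close> and \<open>t\<close>, by opposite amounts. If the
  cut is empty, then summing over \<open>S\<close> shows that there is no imbalance. Otherwise changing the value on \<open>a\<close>
  removes it; afterwards the flow across the cut \<open>{a, b}\<close> is balanced, so \<open>a\<close> has the value of
  \<open>b\<close> up to sign, which is not 0.
\<close>

theorem seymour_six_flow:
  fixes E :: "'e set" and src tgt :: "'e \<Rightarrow> 'v"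
  assumes "finite V" "arc_system E" "\<And>e. e \<in> E \<Longrightarrow> src e \<in> V \<and> tgt e \<in> V"
    and "\<And>S. card (arc_system.cut E src tgt S) \<noteq> 1"
  shows "\<exists>f. arc_system.flow_mod E src tgt 6 f \<and> (\<forall>e\<in>E. \<not> 6 dvd f e)"
  using assms(1,3,4)
proof (induction "card V" arbitrary: V src tgt rule: less_induct)
  case less
  interpret arc_system E src tgt by (rule assms(2))
  show ?case
  proof (cases "\<forall>S. S \<subseteq> V \<longrightarrow> S \<noteq> {} \<longrightarrow> S \<noteq> V \<longrightarrow> 3 \<le> card (cut S)")
    case True
    then show ?thesis using six_flow_of_three_edge_connected [OF less.prems(1,2)] by blast
  next
    case False
    then obtain S where S: "S \<subseteq> V" "S \<noteq> {}" "S \<noteq> V" "\<not> 3 \<le> card (cut S)" by blast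
    have "finite S" using S(1) less.prems(1) finite_subset by blast
    have "card (cut S) = 0 \<or> card (cut S) = 2" using S(4) less.prems(3) [of S] by linarith
    then have small: "cut S = {} \<or> card (cut S) = 2" by simp
    have "\<exists>s t. s \<in> S \<and> t \<in> V - S \<and> (cut S = {} \<or> (\<exists>a\<in>cut S. {src a, tgt a} = {s, t}))"
    proof (cases "cut S = {}")
      case True
      then show ?thesis using S by blast
    next
      case False
      then obtain a where "a \<in> cut S" by blast
      moreover from this have "src a \<in> S \<and> tgt a \<in> V - S \<or> tgt a \<in> S \<and> src a \<in> V - S"
        using less.prems(2) [of a] by (auto simp: cut_def)
      ultimately show ?thesis by (metis insert_commute)
    qed
    then obtain s t where st: "s \<in> S" "t \<in> V - S"
      and arc: "cut S = {} \<or> (\<exists>a\<in>cut S. {src a, tgt a} = {s, t})" by blast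
    have "s \<noteq> t" using st by auto
    define r where "r v = (if v = t then s else v)" for v
    interpret m: arc_system E "r \<circ> src" "r \<circ> tgt" by (rule assms(2))
    have mnet: "m.net f T = net f (r -` T)" for f T by (simp add: m.net_def net_def)
    have mcut: "m.cut T = cut (r -` T)" for T by (simp add: m.cut_def cut_def)
    have "\<exists>f. m.flow_mod 6 f \<and> (\<forall>e\<in>E. \<not> 6 dvd f e)"
    proof (rule less.hyps)
      show "card (V - {t}) < card V"
        using st less.prems(1) by (intro psubset_card_mono) auto
      show "(r \<circ> src) e \<in> V - {t} \<and> (r \<circ> tgt) e \<in> V - {t}" if "e \<in> E" for e
        using less.prems(2) [OF that] st S(1) by (auto simp: r_def)
    qed (use less.prems in \<open>auto simp: mcut\<close>)
    then obtain f where f: "m.flow_mod 6 f" "\<And>e. e \<in> E \<Longrightarrow> \<not> 6 dvd f e" by blast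
    have other: "6 dvd net f {v}" if "v \<noteq> s" "v \<noteq> t" for v
    proof -
      have "r -` {v} = {v}" using that by (auto simp: r_def split: if_splits)
      then have "m.net f {v} = net f {v}" by (simp add: mnet)
      moreover have "6 dvd m.net f {v}" using f(1) by (simp add: m.flow_mod_def)
      ultimately show ?thesis by simp
    qed
    have pair: "6 dvd net f {s} + net f {t}"
    proof -
      have "r -` {s} = {s} \<union> {t}" by (auto simp: r_def split: if_splits)
      then have "m.net f {s} = net f {s} + net f {t}"
        using net_Un_disjoint [of "{s}" "{t}" f] \<open>s \<noteq> t\<close> by (simp add: mnet)
      moreover have "6 dvd m.net f {s}" using f(1) by (simp add: m.flow_mod_def)
      ultimately show ?thesis by simp
    qed
    have net_S: "6 dvd net g S - net g {s}" if "\<And>v. v \<noteq> s \<Longrightarrow> v \<noteq> t \<Longrightarrow> 6 dvd net g {v}" for g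
    proof -
      have "net g S = net g {s} + (\<Sum>v\<in>S - {s}. net g {v})"
        unfolding net_sum_vertices [OF \<open>finite S\<close>] using \<open>finite S\<close> st(1) by (rule sum.remove)
      moreover have "6 dvd (\<Sum>v\<in>S - {s}. net g {v})"
        by (rule dvd_sum) (use that st in auto)
      ultimately show ?thesis by simp
    qed
    show ?thesis
    proof (cases "cut S = {}")
      case True
      then have "net f S = 0"
        unfolding net_def by (intro sum.neutral) (auto simp: cut_def)
      then have s6: "6 dvd net f {s}" using net_S [of f] other by simp
      then have "6 dvd net f {t}" using pair by (simp add: dvd_add_right_iff)
      then have "flow_mod 6 f" using other s6 unfolding flow_mod_def by metis
      then show ?thesis using f(2) by blast
    next
      case False
      then obtain a where a: "a \<in> cut S" "{src a, tgt a} = {s, t}" using arc by blast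
      have "card (cut S) = 2" using small False by blast
      then obtain x y where xy: "cut S = {x, y}" "x \<noteq> y" by (auto simp: card_2_iff)
      obtain b where b: "cut S = {a, b}" "a \<noteq> b"
      proof
        show "cut S = {a, if a = x then y else x}" "a \<noteq> (if a = x then y else x)"
          using a(1) xy by auto
      qed
      have aE: "a \<in> E" and bE: "b \<in> E" using b(1) by (auto simp: cut_def)
      \<comment> \<open>\<open>k\<close> balances \<open>s\<close>, and therefore also \<open>t\<close>.\<close>
      define k where "k = (if src a = s then - net f {s} else net f {s})"
      define g where "g e = f e + k * of_bool (e = a)" for e
      have gnet: "net g {v} = net f {v} + k * (of_bool (src a = v) - of_bool (tgt a = v))" for v
        unfolding g_def net_add net_scale net_single [OF aE] by simp
      have ends: "src a = s \<and> tgt a = t \<or> src a = t \<and> tgt a = s"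
        using a(2) by (auto simp: doubleton_eq_iff)
      have gs: "net g {s} = 0" and gt: "net g {t} = net f {s} + net f {t}"
        using ends \<open>s \<noteq> t\<close> unfolding gnet k_def by auto
      have gother: "6 dvd net g {v}" if "v \<noteq> s" "v \<noteq> t" for v
        using other [OF that] ends that unfolding gnet by auto
      have "6 dvd net g {v}" for v
        using gother [of v] gs gt pair by (cases "v = s"; cases "v = t") auto
      then have flow: "flow_mod 6 g" by (simp add: flow_mod_def)
      define sg :: "'e \<Rightarrow> int" where "sg e = of_bool (src e \<in> S) - of_bool (tgt e \<in> S)" for e
      have "net g S = (\<Sum>e\<in>{a, b}. g e * sg e)"
        unfolding net_def sg_def b(1) [symmetric]
        by (rule sum.mono_neutral_right) (auto simp: finite_arcs cut_def)
      then have "net g S = g a * sg a + g b * sg b" using b(2) by simp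
      moreover have "6 dvd net g S" using net_S [of g] gother gs by simp
      moreover have "a \<in> cut S" "b \<in> cut S" using b(1) by auto
      then have "sg a = 1 \<or> sg a = -1" "sg b = 1 \<or> sg b = -1" by (auto simp: cut_def sg_def)
      moreover have "\<not> 6 dvd g b" using f(2) [OF bE] b(2) by (simp add: g_def)
      ultimately have "\<not> 6 dvd g a" by (elim disjE; simp; presburger)
      moreover have "\<not> 6 dvd g e" if "e \<in> E" "e \<noteq> a" for e
        using f(2) that by (simp add: g_def)
      ultimately show ?thesis using flow by blast
    qed
  qed
qed

text \<open>
  A single arc in a cut would be a bridge: walks avoiding it stay on their side of the cut.
\<close>

lemma cut_card_of_bridgeless:
  assumes "fin_digraph G" "bridgeless G"
  shows "card (arc_system.cut (arcs G) (tail G) (head G) S) \<noteq> 1"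
proof
  interpret fin_digraph G by (rule assms(1))
  interpret arc_system "arcs G" "tail G" "head G" by unfold_locales simp
  assume "card (cut S) = 1"
  then obtain a where a: "cut S = {a}" by (auto simp: card_1_singleton_iff)
  then have "a \<in> cut S" by simp
  then have aG: "a \<in> arcs G" and cross: "(tail G a \<in> S) \<noteq> (head G a \<in> S)" by (auto simp: cut_def)
  let ?H = "mk_symmetric (pre_digraph.del_arc G a)"
  have "tail G a \<rightarrow>\<^sup>*\<^bsub>?H\<^esub> head G a"
    using assms(2) aG by (auto simp: bridgeless_def bridge_def)
  then have "(tail G a, head G a) \<in> (parcs ?H)\<^sup>*"
    unfolding reachable_def by (auto dest: rtrancl_on_rtranclI)
  moreover have same: "u \<in> S \<longleftrightarrow> w \<in> S" if "(u, w) \<in> parcs ?H" for u w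
  proof -
    have "\<exists>e\<in>arcs G - {a}. (u, w) \<in> {(tail G e, head G e), (head G e, tail G e)}"
      using that by (simp add: parcs_mk_symmetric)
    then obtain e where e: "e \<in> arcs G" "e \<noteq> a"
      "(u, w) \<in> {(tail G e, head G e), (head G e, tail G e)}" by blast
    then have "e \<notin> cut S" using a by auto
    then show ?thesis using e by (auto simp: cut_def)
  qed
  have "u \<in> S \<longleftrightarrow> w \<in> S" if "(u, w) \<in> (parcs ?H)\<^sup>*" for u w
    using that
  proof (induction rule: rtrancl_induct)
    case (step y z)
    show ?case using step.IH same [OF step.hyps(2)] by simp
  qed simp
  ultimately show False using cross by metis
qed

section \<open>Flows in groups\<close>

lemma finprod_hom:
  assumes "comm_group H" "comm_group K" "g \<in> hom H K" "f \<in> A \<rightarrow> carrier H"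
  shows "finprod K (g \<circ> f) A = g (finprod H f A)"
proof -
  interpret H: comm_group H by fact
  interpret K: comm_group K by fact
  interpret group_hom H K g by unfold_locales fact
  show ?thesis
  proof (cases "finite A")
    case True
    then show ?thesis
      using assms(4)
    proof (induction A)
      case (insert x A)
      then have f: "f \<in> A \<rightarrow> carrier H" "f x \<in> carrier H" by auto
      then have gf: "g \<circ> f \<in> A \<rightarrow> carrier K" "(g \<circ> f) x \<in> carrier K" by (simp_all add: Pi_iff)
      have "finprod K (g \<circ> f) (insert x A) = (g \<circ> f) x \<otimes>\<^bsub>K\<^esub> finprod K (g \<circ> f) A"
        by (rule K.finprod_insert [OF insert.hyps gf])
      also have "\<dots> = g (f x) \<otimes>\<^bsub>K\<^esub> g (finprod H f A)"
        unfolding insert.IH [OF f(1)] by (rule arg_cong2) simp_all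
      also have "\<dots> = g (finprod H f (insert x A))"
        using f insert.hyps by simp
      finally show ?case .
    qed simp
  qed simp
qed

lemma finprod_integer_group: "finprod integer_group f A = sum f A"
proof -
  interpret comm_group integer_group by (rule abelian_integer_group)
  show ?thesis
    by (induction A rule: infinite_finite_induct) auto
qed

lemma finprod_integer_mod_group:
  assumes "f \<in> A \<rightarrow> carrier (integer_mod_group n)"
  shows "finprod (integer_mod_group n) f A = sum f A mod int n"
proof -
  interpret comm_group "integer_mod_group n" by simp
  show ?thesis
    using assms
  proof (induction A rule: infinite_finite_induct)
    case (insert x A)
    then have "f \<in> A \<rightarrow> carrier (integer_mod_group n)" "f x \<in> carrier (integer_mod_group n)" by auto
    with insert show ?case by (simp add: mod_add_right_eq)
  qed auto
qed

text \<open>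
  The groups of the hypothesis live on two given types. The lemmas up to
  \<open>flow_transfer_between_integer_groups\<close> carry flows, symmetric subsets and homomorphisms of
  Cayley graphs over to isomorphic copies on these types.
\<close>

lemma comm_group_image_group:
  assumes "comm_group H" "inj g"
  shows "comm_group (image_group g H)"
proof -
  interpret comm_group H by fact
  have "g \<in> iso H (image_group g H)"
    using assms(2) by (intro inj_imp_image_group_iso) (auto intro: inj_on_subset)
  then have "H \<cong> image_group g H" by (auto simp: is_iso_def)
  moreover have "group (image_group g H)" 
    by (rule inj_imp_image_group_is_group [OF inj_on_subset [OF assms(2) subset_UNIV]])
  ultimately show ?thesis by (intro iso_imp_comm_group) (auto simp: group_def)
qed

lemma group_hom_image_group:
  assumes "comm_group H" "inj g"
  shows "group_hom H (image_group g H) g"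
proof -
  interpret H: comm_group H by fact
  interpret K: comm_group "image_group g H" by (rule comm_group_image_group) fact+
  have "g \<in> iso H (image_group g H)"
    using assms(2) by (intro inj_imp_image_group_iso) (auto intro: inj_on_subset)
  then show ?thesis by unfold_locales (simp add: iso_def)
qed

lemma diff_image_group:
  assumes "comm_group H" "inj g" "x \<in> carrier H" "y \<in> carrier H"
  shows "g x \<otimes>\<^bsub>image_group g H\<^esub> inv\<^bsub>image_group g H\<^esub> g y = g (x \<otimes>\<^bsub>H\<^esub> inv\<^bsub>H\<^esub> y)"
proof -
  interpret group_hom H "image_group g H" g by (rule group_hom_image_group) fact+
  show ?thesis using assms(3,4) by simp
qed

lemma group_flow_image_group:
  assumes "comm_group H" "inj g" "f \<in> arcs G \<rightarrow> carrier H"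
  shows "group_flow (image_group g H) G (g \<circ> f) \<longleftrightarrow> group_flow H G f"
proof -
  let ?K = "image_group g H"
  interpret H: comm_group H by fact
  interpret group_hom H ?K g by (rule group_hom_image_group) fact+
  have K: "comm_group ?K" by (rule comm_group_image_group) fact+
  have prod: "finprod ?K (g \<circ> f) A = g (finprod H f A)" "finprod H f A \<in> carrier H"
    if "A \<subseteq> arcs G" for A
  proof -
    have "f \<in> A \<rightarrow> carrier H" using that assms(3) by auto
    then show "finprod ?K (g \<circ> f) A = g (finprod H f A)" "finprod H f A \<in> carrier H"
      using finprod_hom [OF assms(1) K homh] H.finprod_closed by auto
  qed
  have "finprod ?K (g \<circ> f) (out_arcs G v) \<otimes>\<^bsub>?K\<^esub> inv\<^bsub>?K\<^esub> (finprod ?K (g \<circ> f) (in_arcs G v))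
      = g (finprod H f (out_arcs G v) \<otimes>\<^bsub>H\<^esub> inv\<^bsub>H\<^esub> (finprod H f (in_arcs G v)))" for v
  proof -
    have sub: "out_arcs G v \<subseteq> arcs G" "in_arcs G v \<subseteq> arcs G" by auto
    show ?thesis
      unfolding prod(1) [OF sub(1)] prod(1) [OF sub(2)]
      using assms(1,2) prod(2) [OF sub(1)] prod(2) [OF sub(2)] by (rule diff_image_group)
  qed
  moreover have "g \<circ> f \<in> arcs G \<rightarrow> carrier ?K"
    using assms(3) by (auto simp: image_group_carrier)
  ultimately show ?thesis
    unfolding group_flow_def image_group_one using assms(3) by (simp only: inj_eq [OF assms(2)])
qed

lemma has_flow_in_image_group:
  assumes "comm_group H" "inj g" "B \<subseteq> carrier H"
  shows "has_flow_in (image_group g H) (g ` B) G \<longleftrightarrow> has_flow_in H B G"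
proof
  assume "has_flow_in H B G"
  then obtain f where f: "group_flow H G f" "\<forall>e\<in>arcs G. f e \<in> B" by (auto simp: has_flow_in_def)
  then have "group_flow (image_group g H) G (g \<circ> f)"
    using group_flow_image_group [OF assms(1,2)] assms(3) by (metis Pi_I subsetD)
  then show "has_flow_in (image_group g H) (g ` B) G"
    unfolding has_flow_in_def using f(2) by (intro exI [of _ "g \<circ> f"]) auto
next
  assume "has_flow_in (image_group g H) (g ` B) G"
  then obtain f where f: "group_flow (image_group g H) G f" "\<forall>e\<in>arcs G. f e \<in> g ` B"
    by (auto simp: has_flow_in_def)
  define f' where "f' = inv_into B g \<circ> f"
  have f': "f' e \<in> B" "g (f' e) = f e" if "e \<in> arcs G" for e
    using f(2) that by (auto simp: f'_def inv_into_into f_inv_into_f)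
  have K: "comm_group (image_group g H)" by (rule comm_group_image_group) fact+
  have prod: "finprod (image_group g H) (g \<circ> f') A = finprod (image_group g H) f A"
    if "A \<subseteq> arcs G" for A
  proof (rule comm_monoid.finprod_cong')
    show "comm_monoid (image_group g H)" using K by (simp add: comm_group_def)
    show "f \<in> A \<rightarrow> carrier (image_group g H)"
      using f(1) that by (auto simp: group_flow_def)
  qed (use f'(2) that in auto)
  have "group_flow (image_group g H) G (g \<circ> f')"
    using f(1) f'(2) prod unfolding group_flow_def
    by (auto simp: Pi_iff in_arcs_def out_arcs_def subset_iff)
  then have "group_flow H G f'"
    using group_flow_image_group [OF assms(1,2), of f' G] f'(1) assms(3) by auto
  then show "has_flow_in H B G" using f'(1) unfolding has_flow_in_def by blast
qed

lemma symmetric_subset_image_group: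
  assumes "comm_group H" "inj g" "symmetric_subset H B"
  shows "symmetric_subset (image_group g H) (g ` B)"
proof -
  interpret group_hom H "image_group g H" g by (rule group_hom_image_group) fact+
  have B: "B \<subseteq> carrier H" "m_inv H ` B = B" using assms(3) by (auto simp: symmetric_subset_def)
  have "m_inv (image_group g H) ` g ` B = (\<lambda>x. g (inv\<^bsub>H\<^esub> x)) ` B"
    unfolding image_image by (rule image_cong) (use B(1) in auto)
  also have "\<dots> = g ` B" using B(2) by (metis image_image)
  finally show ?thesis using B(1) by (auto simp: symmetric_subset_def image_group_carrier)
qed

lemma graph_hom_Cay_image_group:
  assumes "comm_group H" "inj g" "comm_group K" "inj g'" "graph_hom (Cay H B) (Cay K D) k"
  shows "graph_hom (Cay (image_group g H) (g ` B)) (Cay (image_group g' K) (g' ` D))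
    (g' \<circ> k \<circ> inv_into UNIV g)"
proof -
  have k: "k x \<in> carrier K" if "x \<in> carrier H" for x
    using assms(5) that by (auto simp: graph_hom_def Cay_def)
  have step: "k y \<otimes>\<^bsub>K\<^esub> inv\<^bsub>K\<^esub> k x \<in> D"
    if "x \<in> carrier H" "y \<in> carrier H" "y \<otimes>\<^bsub>H\<^esub> inv\<^bsub>H\<^esub> x \<in> B" for x y
    using assms(5) that by (auto simp: graph_hom_def Cay_def)
  show ?thesis
    unfolding graph_hom_def Cay_def
    using assms(1-4) k step
    by (auto simp: image_group_carrier diff_image_group inj_eq)
qed

lemma flow_transfer_between_integer_groups:
  fixes H K :: "int monoid"
  assumes "infinite (UNIV :: 'm set)" "infinite (UNIV :: 'n set)"
    and transfer: "\<And>(M :: 'm monoid) (M' :: 'n monoid) B B'.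
      comm_group M \<Longrightarrow> comm_group M' \<Longrightarrow> symmetric_subset M B \<Longrightarrow> symmetric_subset M' B' \<Longrightarrow>
      \<exists>h. graph_hom (Cay M B) (Cay M' B') h \<Longrightarrow>
      \<forall>G :: ('v, 'e) pre_digraph. fin_digraph G \<longrightarrow> has_flow_in M B G \<longrightarrow> has_flow_in M' B' G"
    and "comm_group H" "comm_group K" "symmetric_subset H B" "symmetric_subset K D"
    and "graph_hom (Cay H B) (Cay K D) k"
    and "fin_digraph (G :: ('v, 'e) pre_digraph)" "has_flow_in H B G"
  shows "has_flow_in K D G"
proof -
  obtain a :: "nat \<Rightarrow> 'm" where a: "inj a" using infinite_countable_subset [OF assms(1)] by blast
  obtain b :: "nat \<Rightarrow> 'n" where b: "inj b" using infinite_countable_subset [OF assms(2)] by blast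
  define g where "g = a \<circ> (to_nat :: int \<Rightarrow> nat)"
  define g' where "g' = b \<circ> (to_nat :: int \<Rightarrow> nat)"
  have g: "inj g" and g': "inj g'" using a b by (auto simp: g_def g'_def intro: inj_compose)
  have sub: "B \<subseteq> carrier H" "D \<subseteq> carrier K" using assms(6,7) by (auto simp: symmetric_subset_def)
  have "has_flow_in (image_group g H) (g ` B) G"
    using has_flow_in_image_group [OF assms(4) g sub(1)] assms(10) by blast
  then have "has_flow_in (image_group g' K) (g' ` D) G"
    using transfer [OF comm_group_image_group [OF assms(4) g] comm_group_image_group [OF assms(5) g']
        symmetric_subset_image_group [OF assms(4) g assms(6)]
        symmetric_subset_image_group [OF assms(5) g' assms(7)]]
      graph_hom_Cay_image_group [OF assms(4) g assms(5) g' assms(8)] assms(9) by blast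
  then show ?thesis using has_flow_in_image_group [OF assms(5) g' sub(2)] by blast
qed

lemma (in arc_system) net_vertex:
  "net f {v} = sum f {e \<in> E. src e = v} - sum f {e \<in> E. tgt e = v}"
proof -
  have "f e * (of_bool (src e \<in> {v}) - of_bool (tgt e \<in> {v}))
      = (if src e = v then f e else 0) - (if tgt e = v then f e else 0)" for e by simp
  then show ?thesis
    unfolding net_def using finite_arcs by (simp add: sum_subtractf sum.inter_filter)
qed

lemma group_flow_integer_group:
  assumes "fin_digraph G"
  shows "group_flow integer_group G f \<longleftrightarrow>
    (\<forall>v\<in>verts G. arc_system.net (arcs G) (tail G) (head G) f {v} = 0)"
proof -
  interpret fin_digraph G by fact
  interpret arc_system "arcs G" "tail G" "head G" by unfold_locales simp
  show ?thesis
    by (simp add: group_flow_def finprod_integer_group net_vertex out_arcs_def in_arcs_def)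
qed

lemma has_flow_in_integer_mod_group_6:
  assumes "fin_digraph G" "bridgeless G"
  shows "has_flow_in (integer_mod_group 6) {1..5} G"
proof -
  interpret fin_digraph G by fact
  interpret arc_system "arcs G" "tail G" "head G" by unfold_locales simp
  have "\<exists>f. flow_mod 6 f \<and> (\<forall>e\<in>arcs G. \<not> 6 dvd f e)"
  proof (rule seymour_six_flow [where V = "verts G"])
    show "arc_system (arcs G)" by unfold_locales
    show "card (cut S) \<noteq> 1" for S by (rule cut_card_of_bridgeless [OF assms])
  qed auto
  then obtain f where f: "flow_mod 6 f" "\<And>e. e \<in> arcs G \<Longrightarrow> \<not> 6 dvd f e" by blast
  define r where "r e = f e mod 6" for e
  have r: "r e \<in> {1..5}" if "e \<in> arcs G" for e
  proof -
    have "r e \<noteq> 0" "0 \<le> r e" "r e < 6" using f(2) [OF that] by (auto simp: r_def dvd_eq_mod_eq_0)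
    then show ?thesis by auto
  qed
  have carrier: "r \<in> A \<rightarrow> carrier (integer_mod_group 6)" for A
    by (auto simp: r_def carrier_integer_mod_group)
  have summod: "sum r A mod 6 = sum f A mod 6" for A
    unfolding r_def by (rule mod_sum_eq)
  have "finprod (integer_mod_group 6) r (out_arcs G v) \<otimes>\<^bsub>integer_mod_group 6\<^esub>
      inv\<^bsub>integer_mod_group 6\<^esub> (finprod (integer_mod_group 6) r (in_arcs G v)) = 0" for v
  proof -
    have "sum f (in_arcs G v) mod 6 \<in> carrier (integer_mod_group 6)"
      by (auto simp: carrier_integer_mod_group)
    then have "finprod (integer_mod_group 6) r (out_arcs G v) \<otimes>\<^bsub>integer_mod_group 6\<^esub>
        inv\<^bsub>integer_mod_group 6\<^esub> (finprod (integer_mod_group 6) r (in_arcs G v))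
        = net f {v} mod 6"
      by (simp add: finprod_integer_mod_group [OF carrier] summod net_vertex
          out_arcs_def in_arcs_def mod_simps)
    then show ?thesis using f(1) by (simp add: flow_mod_def dvd_eq_mod_eq_0)
  qed
  then have "group_flow (integer_mod_group 6) G r"
    using carrier by (simp add: group_flow_def)
  then show ?thesis unfolding has_flow_in_def using r by blast
qed

section \<open>From flows valued in differences of powers to cycle double covers\<close>

text \<open>
  These integers stand for the vectors \<open>e\<^sub>i - e\<^sub>j\<close> of \<open>\<int>\<^sup>6\<close>.
\<close>

definition power_differences :: "int \<Rightarrow> int set" where
  "power_differences N = {N ^ i - N ^ j |i j. i < 6 \<and> j < 6 \<and> i \<noteq> j}"

lemma symmetric_power_differences: "symmetric_subset integer_group (power_differences N)"
proof -
  have neg: "- x \<in> power_differences N" if "x \<in> power_differences N" for x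
  proof -
    from that obtain i j where "x = N ^ i - N ^ j" "i < 6" "j < 6" "i \<noteq> j"
      by (auto simp: power_differences_def)
    then have "- x = N ^ j - N ^ i" "j < 6" "i < 6" "j \<noteq> i" by auto
    then show ?thesis unfolding power_differences_def by blast
  qed
  have "uminus ` power_differences N = power_differences N"
  proof (intro equalityI subsetI)
    fix x assume "x \<in> power_differences N"
    then show "x \<in> uminus ` power_differences N"
      using neg [of x] by (intro image_eqI [of _ _ "- x"]) auto
  qed (use neg in auto)
  moreover have "m_inv integer_group = uminus" by (rule ext) simp
  ultimately show ?thesis by (simp add: symmetric_subset_def)
qed

lemma symmetric_nonzero_residues: "symmetric_subset (integer_mod_group 6) {1..5}"
proof -
  have car: "{1..5} \<subseteq> carrier (integer_mod_group 6)" by (auto simp: carrier_integer_mod_group)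
  have "m_inv (integer_mod_group 6) ` {1..5} = (\<lambda>x. 6 - x) ` {1..5}"
  proof (rule image_cong)
    fix x :: int assume "x \<in> {1..5}"
    then have "x \<in> carrier (integer_mod_group 6)" "(- x) mod 6 = 6 - x"
      using car by (auto simp: zmod_zminus1_eq_if)
    then show "inv\<^bsub>integer_mod_group 6\<^esub> x = 6 - x" by simp
  qed simp
  also have "(\<lambda>x. 6 - x) ` {1..5} = {1..5 :: int}"
  proof (intro equalityI subsetI)
    fix x :: int assume "x \<in> {1..5}"
    then show "x \<in> (\<lambda>x. 6 - x) ` {1..5}" by (intro image_eqI [of _ _ "6 - x"]) auto
  qed auto
  finally show ?thesis using car by (simp add: symmetric_subset_def)
qed

lemma graph_hom_residue_to_power:
  "graph_hom (Cay (integer_mod_group 6) {1..5}) (Cay integer_group (power_differences N))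
    (\<lambda>x. N ^ nat x)"
proof -
  have "N ^ nat y - N ^ nat x \<in> power_differences N"
    if "0 \<le> x" "x < 6" "0 \<le> y" "y < 6" "y \<noteq> x" for x y :: int
  proof -
    have "nat y < 6" "nat x < 6" "nat y \<noteq> nat x" using that by auto
    then show ?thesis unfolding power_differences_def by blast
  qed
  moreover have "y \<noteq> x" if "x \<in> carrier (integer_mod_group 6)"
    "y \<otimes>\<^bsub>integer_mod_group 6\<^esub> inv\<^bsub>integer_mod_group 6\<^esub> x \<in> {1..5}" for x y
    using that by (auto simp: mod_simps)
  ultimately show ?thesis
    unfolding graph_hom_def Cay_def by (auto simp: carrier_integer_mod_group)
qed

text \<open>
  Uniqueness of the base-\<open>N\<close> expansion of 0 with signed digits: modulo \<open>N\<close> only the lowest digit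
  survives, so it is 0, and \<open>N\<close> can be divided out.
\<close>

lemma digits_eq_0:
  fixes c :: "nat \<Rightarrow> int"
  assumes "(\<Sum>i<k. N ^ i * c i) = 0" "\<And>i. i < k \<Longrightarrow> \<bar>c i\<bar> < N" "i < k"
  shows "c i = 0"
  using assms
proof (induction k arbitrary: c i)
  case (Suc k)
  have split: "(\<Sum>i<Suc k. N ^ i * c i) = c 0 + N * (\<Sum>i<k. N ^ i * c (Suc i))"
    unfolding sum.lessThan_Suc_shift by (simp add: sum_distrib_left algebra_simps)
  then have "c 0 = - (N * (\<Sum>i<k. N ^ i * c (Suc i)))" using Suc.prems(1) by linarith
  then have "N dvd c 0" by simp
  then have c0: "c 0 = 0" using Suc.prems(2) [of 0] dvd_imp_le_int [of "c 0" N] by force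
  moreover have "N \<noteq> 0" using Suc.prems(2) [of 0] by auto
  ultimately have "(\<Sum>i<k. N ^ i * c (Suc i)) = 0" using split Suc.prems(1) by simp
  then have "c (Suc j) = 0" if "j < k" for j
    using Suc.IH [of "\<lambda>i. c (Suc i)" j] Suc.prems(2) that by simp
  then show ?case using c0 Suc.prems(3) by (cases i) auto
qed simp

text \<open>
  If \<open>e\<close> carries \<open>N ^ i - N ^ j\<close>, let it lie in the cycle \<open>i\<close> forwards and in the cycle \<open>j\<close>
  backwards. The flow condition at a vertex \<open>v\<close> says that the net outflows of the six cycles
  at \<open>v\<close> are the digits of 0. Each is bounded by the number of arcs, hence smaller than \<open>N\<close>.
\<close>

lemma cycle_double_cover_of_power_difference_flow:
  assumes "fin_digraph G" "N = int (card (arcs G)) + 1"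
    and "has_flow_in integer_group (power_differences N) G"
  shows "\<exists>C. orientable_cycle_double_cover G 6 C"
proof -
  interpret fin_digraph G by fact
  interpret arc_system "arcs G" "tail G" "head G" by unfold_locales simp
  obtain f where f: "\<And>v. v \<in> verts G \<Longrightarrow> net f {v} = 0" "\<forall>e\<in>arcs G. f e \<in> power_differences N"
    using assms(3) unfolding has_flow_in_def group_flow_integer_group [OF assms(1)] by blast
  then have "\<forall>e\<in>arcs G. \<exists>i j. f e = N ^ i - N ^ j \<and> i < 6 \<and> j < 6 \<and> i \<noteq> j"
    by (auto simp: power_differences_def)
  then obtain I J where IJ: "\<And>e. e \<in> arcs G \<Longrightarrow>
      f e = N ^ I e - N ^ J e \<and> I e < (6::nat) \<and> J e < (6::nat) \<and> I e \<noteq> J e"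
    by metis
  define C :: "nat \<Rightarrow> _ \<Rightarrow> int" where "C l e = of_bool (l = I e) - of_bool (l = J e)" for l e
  have fC: "f e = (\<Sum>l<6. N ^ l * C l e)" if "e \<in> arcs G" for e
  proof -
    have "(\<Sum>l<6. N ^ l * C l e)
        = (\<Sum>l<6. if l = I e then N ^ l else 0) - (\<Sum>l<6. if l = J e then N ^ l else 0)"
      unfolding sum_subtractf [symmetric] by (rule sum.cong) (auto simp: C_def)
    also have "\<dots> = N ^ I e - N ^ J e" using IJ [OF that] by simp
    finally show ?thesis using IJ [OF that] by simp
  qed
  have cycle: "net (C l) {v} = 0" if "l < 6" "v \<in> verts G" for l v
  proof (rule digits_eq_0 [where c = "\<lambda>l. net (C l) {v}" and k = 6 and N = N])
    let ?w = "\<lambda>e. of_bool (tail G e \<in> {v}) - of_bool (head G e \<in> {v}) :: int"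
    have "net f {v} = (\<Sum>e\<in>arcs G. \<Sum>l<6. N ^ l * (C l e * ?w e))"
      unfolding net_def
      by (rule sum.cong) (simp_all add: fC sum_distrib_right mult.assoc)
    also have "\<dots> = (\<Sum>l<6. N ^ l * net (C l) {v})"
      unfolding net_def sum_distrib_left by (rule sum.swap)
    finally show "(\<Sum>l<6. N ^ l * net (C l) {v}) = 0" using f(1) that(2) by simp
    show "\<bar>net (C l) {v}\<bar> < N" for l
    proof -
      have "\<bar>net (C l) {v}\<bar> \<le> (\<Sum>e\<in>arcs G. \<bar>C l e * ?w e\<bar>)"
        unfolding net_def by (rule sum_abs)
      also have "\<dots> \<le> (\<Sum>e\<in>arcs G. 1)"
        by (rule sum_mono) (auto simp: C_def)
      finally show ?thesis using assms(2) by simp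
    qed
  qed (rule that)
  have "orientable_cycle_double_cover G 6 C"
    unfolding orientable_cycle_double_cover_def directed_cycle_def
      group_flow_integer_group [OF assms(1)]
  proof (intro conjI allI impI ballI)
    fix e assume e: "e \<in> arcs G"
    show "\<exists>i<6. \<exists>j<6. C i e = 1 \<and> C j e = - 1 \<and> (\<forall>l<6. l \<noteq> i \<longrightarrow> l \<noteq> j \<longrightarrow> C l e = 0)"
      using IJ [OF e] by (intro exI [of _ "I e"] conjI exI [of _ "J e"]) (auto simp: C_def)
  qed (auto simp: cycle, auto simp: C_def)
  then show ?thesis by blast
qed

theorem corollary16:
  assumes "infinite (UNIV :: 'm set)" and "infinite (UNIV :: 'n set)"
    and "\<And>(M :: 'm monoid) (M' :: 'n monoid) B B'.
      comm_group M \<Longrightarrow> comm_group M' \<Longrightarrow> symmetric_subset M B \<Longrightarrow> symmetric_subset M' B' \<Longrightarrow>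
      \<exists>h. graph_hom (Cay M B) (Cay M' B') h \<Longrightarrow>
      \<forall>G :: ('v, 'e) pre_digraph. fin_digraph G \<longrightarrow> has_flow_in M B G \<longrightarrow> has_flow_in M' B' G"
  shows "\<forall>G :: ('v, 'e) pre_digraph. fin_digraph G \<longrightarrow> bridgeless G \<longrightarrow>
      (\<exists>k\<le>6. \<exists>C. orientable_cycle_double_cover G k C)"
proof (intro allI impI)
  fix G :: "('v, 'e) pre_digraph"
  assume G: "fin_digraph G" "bridgeless G"
  define N where "N = int (card (arcs G)) + 1"
  have "has_flow_in integer_group (power_differences N) G"
    by (rule flow_transfer_between_integer_groups [OF assms abelian_integer_mod_group
          abelian_integer_group symmetric_nonzero_residues symmetric_power_differences
          graph_hom_residue_to_power G(1) has_flow_in_integer_mod_group_6 [OF G]])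
  then have "\<exists>C. orientable_cycle_double_cover G 6 C"
    by (rule cycle_double_cover_of_power_difference_flow [OF G(1) N_def])
  then show "\<exists>k\<le>6. \<exists>C. orientable_cycle_double_cover G k C" by blast
qed

end
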